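(* Let $n\ge1$ and let $T$ be a $2$-triangulation on the half-cylinder $\mathcal{C}_n$, which lifts to $\overline{T}=\pi^{-1}(T)$ on the universal cover $\overline{\mathcal{C}}_n$. Let $e$ be an edge on $\overline{\mathcal{C}}_n$ of length at least $2$ and at most $2n$ that is not contained in $\overline{T}$. Then $\overline{T}\cup\{e\}$ contains a $3$-crossing.
   Context: **Half-cylinder and universal cover.** $\mathcal{C}_n$ is the annulus with $n$ marked points on one of its boundary components (and none on the other). Its universal cover $\overline{\mathcal{C}}_n$ has vertices $\alpha_i$, $i\in\mathbb{Z}$ (the lifts of the marked points, in order along the boundary line); the covering map $\pi$ sends $\alpha_i$ to the marked point indexed by $i \bmod n$. Write $\alpha_i+j=\alpha_{i+j}$, $\alpha_j-\alpha_i=j-i$, and $\alpha_i<\alpha_j$ iff $i<j$. An edge of $\overline{\mathcal{C}}_n$ is an isotopy class of curves joining two distinct vertices $u,v$; it is determined by the unordered pair and denoted $[u,v]=[v,u]$. Its length is $|v-u|$. Put $[u,v]+j=[u+j,v+j]$; a translation of $e$ is an edge $e+\ell n$ with $\ell\in\mathbb{Z}$. An edge of $\mathcal{C}_n$ is a projection $\pi(e)$, with $\pi(e)=\pi(f)$ iff $f$ is a translation of $e$; the length of $\pi(e)$ is the length of $e$. **Crossings.** Two edges of $\overline{\mathcal{C}}_n$ intersect iff they can be written $[a_1,b_1]$, $[a_2,b_2]$ with $a_1<a_2<b_1<b_2$. A $3$-crossing is a set of three pairwise intersecting edges. **$2$-triangulations.** A $2$-triangulation on $\mathcal{C}_n$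 is an inclusion-maximal set $T$ of edges of $\mathcal{C}_n$ such that $\pi^{-1}(T)$ contains no $3$-crossing. Convention: edges of length $<2$ (which never occur in a $3$-crossing) are disregarded, i.e. only edges of length $\ge 2$ are considered. *)

theory Defs
  imports Main
begin

text \<open>
  The vertex \<open>\<alpha>_i\<close> of the universal cover of the half-cylinder is the integer \<open>i\<close>, and the edge
  \<open>[u,v] = [v,u]\<close> is the two-element set \<open>{u, v}\<close>.
\<close>

type_synonym edge = "int set"

definition edges :: "edge set" where
  "edges = {{u, v} | u v. u \<noteq> v}"

definition edge_length :: "edge \<Rightarrow> int" where
  "edge_length e = Max e - Min e"

lemma edge_length_pair: "edge_length {u, v} = \<bar>v - u\<bar>"
  by (simp add: edge_length_def max_def min_def)

definition shift :: "edge \<Rightarrow> int \<Rightarrow> edge" where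
  "shift e j = (\<lambda>x. x + j) ` e"

lemma shift_pair: "shift {u, v} j = {u + j, v + j}"
  by (simp add: shift_def)

text \<open>
  An edge of the half-cylinder with \<open>n\<close> marked points is identified with the set of all its lifts.
  The projection of an edge is therefore its class under translations by multiples of \<open>n\<close>.
\<close>

type_synonym cyl_edge = "edge set"

definition proj :: "nat \<Rightarrow> edge \<Rightarrow> cyl_edge" where
  "proj n e = {shift e (l * int n) | l. True}"

lemma proj_eq_iff: "proj n e = proj n f \<longleftrightarrow> (\<exists>l. f = shift e (l * int n))"
proof
  assume "proj n e = proj n f"
  moreover have "f \<in> proj n f"
    by (auto simp: proj_def shift_def intro: exI[of _ 0])
  ultimately show "\<exists>l. f = shift e (l * int n)"
    by (auto simp: proj_def)
next
  assume "\<exists>l. f = shift e (l * int n)"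
  then obtain l where f: "f = shift e (l * int n)" ..
  have shift: "shift f (m * int n) = shift e ((l + m) * int n)" for m
    by (simp add: f shift_def image_image algebra_simps)
  show "proj n e = proj n f"
  proof (intro equalityI subsetI)
    fix g assume "g \<in> proj n e"
    then obtain m where "g = shift e (m * int n)" by (auto simp: proj_def)
    then have "g = shift f ((m - l) * int n)" by (simp add: shift)
    then show "g \<in> proj n f" by (auto simp: proj_def)
  next
    fix g assume "g \<in> proj n f"
    then show "g \<in> proj n e" by (auto simp: proj_def shift)
  qed
qed

text \<open>
  Edges of length less than 2 never occur in a 3-crossing and are disregarded.
\<close>

definition cyl_edges :: "nat \<Rightarrow> cyl_edge set" where
  "cyl_edges n = proj n ` {e \<in> edges. edge_length e \<ge> 2}"

definition lift :: "nat \<Rightarrow> cyl_edge set \<Rightarrow> edge set" where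
  "lift n T = {e \<in> edges. proj n e \<in> T}"

definition intersects :: "edge \<Rightarrow> edge \<Rightarrow> bool" where
  "intersects e f \<longleftrightarrow>
     (\<exists>a1 b1 a2 b2. {e, f} = {{a1, b1}, {a2, b2}} \<and> a1 < a2 \<and> a2 < b1 \<and> b1 < b2)"

definition three_crossing :: "edge set \<Rightarrow> bool" where
  "three_crossing X \<longleftrightarrow> X \<subseteq> edges \<and> card X = 3 \<and> pairwise intersects X"

definition contains_three_crossing :: "edge set \<Rightarrow> bool" where
  "contains_three_crossing S \<longleftrightarrow> (\<exists>X \<subseteq> S. three_crossing X)"

definition two_triangulation :: "nat \<Rightarrow> cyl_edge set \<Rightarrow> bool" where
  "two_triangulation n T \<longleftrightarrow>
     T \<subseteq> cyl_edges n \<and> \<not> contains_three_crossing (lift n T) \<and>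
     (\<forall>T'. T' \<subseteq> cyl_edges n \<and> \<not> contains_three_crossing (lift n T') \<and> T \<subseteq> T' \<longrightarrow> T' = T)"

end

theory Submission
  imports Defs
begin

text \<open>
  Suppose that \<open>e = [a,b]\<close> forms no 3-crossing with two edges of \<open>lift n T\<close>. By maximality of \<open>T\<close>
  some 3-crossing uses several translates of \<open>e\<close>. As \<open>e\<close> has length at most \<open>2n\<close>, it consists of
  two consecutive translates \<open>e\<close>, \<open>e + n\<close> and one edge \<open>[c,d]\<close> of the triangulation, and comparing
  with the translates of \<open>[c,d]\<close> leaves only the order \<open>a < b - n < c < a + n < b < d\<close>. Edges of
  length \<open>n\<close> do not cross their translates. Hence, if \<open>[a,a+n]\<close> were not in the triangulation, it
  would be crossed by two crossing edges of the triangulation, and exchanging one of these with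
  \<open>[c,d]\<close> would give two crossing edges that both cross \<open>e\<close> or both cross \<open>e + n\<close>. So \<open>[a,a+n]\<close> and,
  by reflection, \<open>[b-n,b]\<close> belong to the triangulation. Together with \<open>[c,d]\<close> they form a 3-crossing.
\<close>

section \<open>Triples of pairwise crossing arcs on the integers\<close>

text \<open>A 3-crossing listed by increasing left ends: pairwise crossing forces exactly this order
  of the six end points.\<close>

definition has_triple :: "(int \<Rightarrow> int \<Rightarrow> bool) \<Rightarrow> bool" where
  "has_triple R \<longleftrightarrow> (\<exists>a1 a2 a3 b1 b2 b3. a1 < a2 \<and> a2 < a3 \<and> a3 < b1 \<and> b1 < b2 \<and> b2 < b3 \<and>
     R a1 b1 \<and> R a2 b2 \<and> R a3 b3)"

lemma has_tripleI:
  assumes "R a1 b1" "R a2 b2" "R a3 b3"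
    and "a1 < a2" "a2 < a3" "a3 < b1" "b1 < b2" "b2 < b3"
  shows "has_triple R"
  using assms unfolding has_triple_def by blast

lemma has_tripleE:
  assumes "has_triple R"
  obtains a1 a2 a3 b1 b2 b3 where "R a1 b1" "R a2 b2" "R a3 b3"
    and "a1 < a2" "a2 < a3" "a3 < b1" "b1 < b2" "b2 < b3"
  using assms unfolding has_triple_def by blast

lemma has_triple_reindex:
  assumes "has_triple R" and "\<And>i j. R i j \<Longrightarrow> S (i + k) (j + k)"
  shows "has_triple S"
  using assms(1)
proof (rule has_tripleE)
  fix a1 a2 a3 b1 b2 b3
  assume "R a1 b1" "R a2 b2" "R a3 b3"
    and "a1 < a2" "a2 < a3" "a3 < b1" "b1 < b2" "b2 < b3"
  then show ?thesis
    by (intro has_tripleI[of S "a1 + k" "b1 + k" "a2 + k" "b2 + k" "a3 + k" "b3 + k"] assms(2)) auto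
qed

lemma has_triple_reflect:
  assumes "has_triple R" and "\<And>i j. R i j \<Longrightarrow> S (- j) (- i)"
  shows "has_triple S"
  using assms(1)
proof (rule has_tripleE)
  fix a1 a2 a3 b1 b2 b3
  assume "R a1 b1" "R a2 b2" "R a3 b3"
    and "a1 < a2" "a2 < a3" "a3 < b1" "b1 < b2" "b2 < b3"
  then show ?thesis
    by (intro has_tripleI[of S "- b3" "- a3" "- b2" "- a2" "- b1" "- a1"] assms(2)) auto
qed

definition add_arc :: "(int \<Rightarrow> int \<Rightarrow> bool) \<Rightarrow> int \<Rightarrow> int \<Rightarrow> int \<Rightarrow> int \<Rightarrow> bool" where
  "add_arc R u v i j \<longleftrightarrow> R i j \<or> (i = u \<and> j = v)"

text \<open>Models adding the projection of \<open>[u,v]\<close> to the triangulation, which is what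
  maximality speaks about; \<open>add_arc\<close> adds a single lift, as the final claim
  requires.\<close>

definition add_orbit :: "int \<Rightarrow> (int \<Rightarrow> int \<Rightarrow> bool) \<Rightarrow> int \<Rightarrow> int \<Rightarrow> int \<Rightarrow> int \<Rightarrow> bool" where
  "add_orbit n R u v i j \<longleftrightarrow> R i j \<or> (\<exists>l. i = u + l * n \<and> j = v + l * n)"

text \<open>Maximality is left to hypotheses named \<open>saturated\<close>, so that only
  periodicity and absence of triples must be carried over to the reflected family.\<close>

locale periodic_arcs =
  fixes n :: int and A :: "int \<Rightarrow> int \<Rightarrow> bool"
  assumes n_pos: "n > 0"
    and periodic: "A (i + l * n) (j + l * n) \<longleftrightarrow> A i j"
    and no_triple: "\<not> has_triple A"
begin

lemma next_translate: "A i j \<Longrightarrow> A (i + n) (j + n)"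
  using periodic[of i 1 j] by simp

lemma prev_translate: "A i j \<Longrightarrow> A (i - n) (j - n)"
  using periodic[of i "-1" j] by simp

lemma has_triple_add_arc_translate:
  "has_triple (add_arc A (u + l * n) (v + l * n)) \<longleftrightarrow> has_triple (add_arc A u v)"
proof
  assume "has_triple (add_arc A (u + l * n) (v + l * n))"
  then show "has_triple (add_arc A u v)"
    by (rule has_triple_reindex[where k = "- l * n"])
      (use periodic[of _ "- l"] in \<open>auto simp: add_arc_def\<close>)
next
  assume "has_triple (add_arc A u v)"
  then show "has_triple (add_arc A (u + l * n) (v + l * n))"
    by (rule has_triple_reindex[where k = "l * n"]) (auto simp: add_arc_def periodic)
qed

text \<open>The bound \<open>2 * n\<close> enters here: the offset of two crossing translates is a
  positive multiple of \<open>n\<close> smaller than their length.\<close>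

lemma orbit_crossing:
  assumes "u + l * n < u + m * n" "u + m * n < v + l * n" "v - u \<le> 2 * n"
  shows "m = l + 1"
proof -
  have "l < m"
    using assms(1) n_pos by simp
  have "(m - l) * n < 2 * n"
    using assms by (simp add: algebra_simps)
  then have "m - l < 2"
    using n_pos by simp
  with \<open>l < m\<close> show ?thesis
    by simp
qed

lemma crossing_two_translates:
  assumes triple: "has_triple (add_orbit n A u v)"
    and free: "\<not> has_triple (add_arc A u v)"
    and len: "v - u \<le> 2 * n"
  obtains c d where "A c d" "u < c" "c < u + n" "u + n < v" "v < d" "d \<le> c + n"
proof -
  have free': "\<not> has_triple (add_arc A (u + l * n) (v + l * n))" for l
    using free has_triple_add_arc_translate by blast
  obtain a1 a2 a3 b1 b2 b3 where
    R: "add_orbit n A u v a1 b1" "add_orbit n A u v a2 b2" "add_orbit n A u v a3 b3"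
    and ord: "a1 < a2" "a2 < a3" "a3 < b1" "b1 < b2" "b2 < b3"
    using triple by (rule has_tripleE)
  have no_single: False if "add_arc A (u + l * n) (v + l * n) a1 b1"
    "add_arc A (u + l * n) (v + l * n) a2 b2" "add_arc A (u + l * n) (v + l * n) a3 b3" for l
    using has_tripleI[OF that ord] free' by blast
  \<comment> \<open>The three alternatives put \<open>[p,q]\<close> first, second or third in a
    triple with the translates of \<open>[u,v]\<close> by \<open>l * n\<close> and
    \<open>l * n + n\<close>.\<close>
  have shifted: "\<exists>c d. A c d \<and> u < c \<and> c < u + n \<and> u + n < v \<and> v < d \<and> d \<le> c + n"
    if "A p q" and pos: "p < u + l * n \<and> u + l * n + n < q \<and> q < v + l * n \<or>
          u + l * n < p \<and> p < u + l * n + n \<and> u + l * n + n < v + l * n \<and>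
            v + l * n < q \<and> q < v + l * n + n \<or>
          u + l * n + n < p \<and> p < v + l * n \<and> v + l * n + n < q" for p q l
  proof -
    define c d where "c = p - l * n" and "d = q - l * n"
    have cd: "A c d"
      using that(1) periodic[of p "- l" q] by (simp add: c_def d_def)
    have e: "add_arc A u v u v" and T: "A i j \<Longrightarrow> add_arc A u v i j" for i j
      by (auto simp: add_arc_def)
    \<comment> \<open>Exchanging \<open>[u + n, v + n]\<close> for this translate leaves a triple
      with a single copy of \<open>[u,v]\<close> if \<open>[c,d]\<close> is first or third, and also
      if it is second with \<open>c + n < d\<close>. Only the middle place with
      \<open>d \<le> c + n\<close> survives.\<close>
    have prev: "A (c - n) (d - n)"
      using cd by (rule prev_translate)
    consider "c < u" "u + n < d" "d < v" | "u < c" "c < u + n" "u + n < v" "v < d" "d < v + n"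
      | "u + n < c" "c < v" "v + n < d"
      using pos by (auto simp: c_def d_def)
    then show ?thesis
    proof cases
      case 1
      then show ?thesis
        using has_tripleI[where R = "add_arc A u v", OF T[OF prev] T[OF cd] e] free n_pos by auto
    next
      case 2
      then show ?thesis
        using has_tripleI[where R = "add_arc A u v", OF T[OF prev] e T[OF cd]] free cd n_pos by force
    next
      case 3
      then show ?thesis
        using has_tripleI[where R = "add_arc A u v", OF e T[OF prev] T[OF cd]] free n_pos by auto
    qed
  qed
  have "\<exists>c d. A c d \<and> u < c \<and> c < u + n \<and> u + n < v \<and> v < d \<and> d \<le> c + n"
  proof -
    consider (none) "A a1 b1" "A a2 b2" "A a3 b3"
      | (one1) l where "a1 = u + l * n" "b1 = v + l * n" "A a2 b2" "A a3 b3"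
      | (one2) l where "A a1 b1" "a2 = u + l * n" "b2 = v + l * n" "A a3 b3"
      | (one3) l where "A a1 b1" "A a2 b2" "a3 = u + l * n" "b3 = v + l * n"
      | (two12) l m where "a1 = u + l * n" "b1 = v + l * n" "a2 = u + m * n" "b2 = v + m * n"
          "A a3 b3"
      | (two13) l m where "a1 = u + l * n" "b1 = v + l * n" "A a2 b2" "a3 = u + m * n"
          "b3 = v + m * n"
      | (two23) l m where "A a1 b1" "a2 = u + l * n" "b2 = v + l * n" "a3 = u + m * n"
          "b3 = v + m * n"
      | (three) k l m where "a1 = u + k * n" "b1 = v + k * n" "a2 = u + l * n" "b2 = v + l * n"
          "a3 = u + m * n" "b3 = v + m * n"
      using R unfolding add_orbit_def by metis
    then show ?thesis
    proof cases
      case none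
      then show ?thesis
        using has_tripleI[OF none ord] no_triple by blast
    next
      case one1
      then show ?thesis
        using no_single[of l] by (auto simp: add_arc_def)
    next
      case one2
      then show ?thesis
        using no_single[of l] by (auto simp: add_arc_def)
    next
      case one3
      then show ?thesis
        using no_single[of l] by (auto simp: add_arc_def)
    next
      case two12
      then have "m = l + 1"
        using ord len by (intro orbit_crossing[of u l m v]) linarith+
      then show ?thesis
        using two12 ord by (intro shifted[of a3 b3 l]) (auto simp: algebra_simps)
    next
      case two13
      then have "m = l + 1"
        using ord len by (intro orbit_crossing[of u l m v]) linarith+
      then show ?thesis
        using two13 ord by (intro shifted[of a2 b2 l]) (auto simp: algebra_simps)
    next
      case two23
      then have "m = l + 1"
        using ord len by (intro orbit_crossing[of u l m v]) linarith+
      then show ?thesis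
        using two23 ord by (intro shifted[of a1 b1 l]) (auto simp: algebra_simps)
    next
      case three
      \<comment> \<open>The second and third translates would both have to be the successor of the
        first.\<close>
      then have "m = k + 1"
        using ord len by (intro orbit_crossing[of u k m v]) linarith+
      moreover from three have "l = k + 1"
        using ord len by (intro orbit_crossing[of u k l v]) linarith+
      ultimately show ?thesis
        using three ord by auto
    qed
  qed
  then show thesis
    using that by blast
qed

section \<open>Edges of length \<open>n\<close> at the two ends of \<open>[a,b]\<close>\<close>

text \<open>\<open>[c,d]\<close> crosses both \<open>[a,b]\<close> and
  \<open>[a + n, b + n]\<close>, so it can replace an edge crossing \<open>[a, a + n]\<close>. The
  cases are the place of \<open>[a, a + n]\<close> in the supposed triple.\<close>

lemma arc_of_length_n_at_left_end:
  assumes saturated: "\<not> A a (a + n) \<Longrightarrow> has_triple (add_arc A a (a + n))"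
    and free: "\<not> has_triple (add_arc A a b)"
    and f: "A c d" "a < c" "c < a + n" "a + n < b" "b < d" "d < b + n"
  shows "A a (a + n)"
proof (rule ccontr)
  assume notin: "\<not> A a (a + n)"
  have free': "\<not> has_triple (add_arc A (a + n) (b + n))"
    using free has_triple_add_arc_translate[of a 1 b] by simp
  have e: "add_arc A u v u v" and T: "A i j \<Longrightarrow> add_arc A u v i j" for u v i j
    by (auto simp: add_arc_def)
  note E0 = has_tripleI[where R = "add_arc A a b"]
    and E = has_tripleI[where R = "add_arc A (a + n) (b + n)"]
  obtain a1 a2 a3 b1 b2 b3 where
    R: "add_arc A a (a + n) a1 b1" "add_arc A a (a + n) a2 b2" "add_arc A a (a + n) a3 b3"
    and ord: "a1 < a2" "a2 < a3" "a3 < b1" "b1 < b2" "b2 < b3"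
    using saturated[OF notin] by (rule has_tripleE)
  have "\<not> (A a1 b1 \<and> A a2 b2 \<and> A a3 b3)"
    using has_tripleI[of A, OF _ _ _ ord] no_triple by blast
  then consider
      (first) "a1 = a" "b1 = a + n" "A a2 b2" "A a3 b3"
    | (mid) "A a1 b1" "a2 = a" "b2 = a + n" "A a3 b3"
    | (last) "A a1 b1" "A a2 b2" "a3 = a" "b3 = a + n"
    using R ord by (auto simp: add_arc_def)
  then show False
  proof cases
    case first
    note x = first(3) and y = first(4)
    \<comment> \<open>If \<open>b2 > b\<close>, then \<open>[a,b]\<close>, \<open>x\<close>,
      \<open>y\<close> form a triple; if \<open>b3 < b + n\<close>, then \<open>x\<close>,
      \<open>y\<close>, \<open>[a + n, b + n]\<close> do; if \<open>a2 < c\<close>, then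
      \<open>x\<close>, \<open>[c,d]\<close>, \<open>[a + n, b + n]\<close> do. What remains makes
      \<open>[a,b]\<close>, \<open>[c,d]\<close>, \<open>y\<close> a triple.\<close>
    have "b2 \<le> b"
      using E0[OF e T[OF x] T[OF y]] free first ord f by force
    moreover have "b3 \<ge> b + n"
      using E[OF T[OF x] T[OF y] e] free' first ord f by force
    moreover have "c \<le> a2"
      using E[OF T[OF x] T[OF f(1)] e] free' first ord f calculation
      by force
    ultimately show False
      using E0[OF e T[OF f(1)] T[OF y]] free first ord f by force
  next
    case mid
    note x = mid(1) and y = mid(4)
    have "b3 \<le> b"
      using E0[OF T[OF x] e T[OF y]] free mid ord f by force
    then have "c \<le> a3"
      using E[OF T[OF y] T[OF f(1)] e] free' mid ord f by force
    then show False
      using E0[OF T[OF x] e T[OF f(1)]] free mid ord f by force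
  next
    case last
    \<comment> \<open>Both edges already cross \<open>[a,b]\<close>, as
      \<open>b2 < a + n < b\<close>.\<close>
    then show False
      using E0[OF T[OF last(1)] T[OF last(2)] e] free ord f by force
  qed
qed

text \<open>Negation swaps left and right ends, so the result at the left end yields its mirror
  image.\<close>

lemma reflected: "periodic_arcs n (\<lambda>i j. A (- j) (- i))"
proof
  show "A (- (j + l * n)) (- (i + l * n)) \<longleftrightarrow> A (- j) (- i)" for i j l
    using periodic[of "- j" "- l" "- i"] by (simp add: algebra_simps)
  show "\<not> has_triple (\<lambda>i j. A (- j) (- i))"
    using has_triple_reflect[of "\<lambda>i j. A (- j) (- i)" A] no_triple by auto
qed (rule n_pos)

lemma arc_of_length_n_at_right_end:
  assumes saturated: "\<not> A (b - n) b \<Longrightarrow> has_triple (add_arc A (b - n) b)"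
    and free: "\<not> has_triple (add_arc A a b)"
    and f: "A c d" "a < c" "c < a + n" "a + n < b" "b < d" "d < b + n"
  shows "A (b - n) b"
proof -
  interpret r: periodic_arcs n "\<lambda>i j. A (- j) (- i)"
    by (rule reflected)
  have reflect: "has_triple (add_arc (\<lambda>i j. A (- j) (- i)) (- v) (- u)) \<longleftrightarrow> has_triple (add_arc A u v)"
    for u v
    by (rule iffI; erule has_triple_reflect) (auto simp: add_arc_def)
  have "has_triple (add_arc (\<lambda>i j. A (- j) (- i)) (- b) (- b + n))"
    if "\<not> A (- (- b + n)) (- (- b))"
    using that saturated reflect[where u = "b - n" and v = b] by simp
  moreover have "\<not> has_triple (add_arc (\<lambda>i j. A (- j) (- i)) (- b) (- a))"
    using free reflect by blast
  \<comment> \<open>The mirror image of \<open>[c,d]\<close> starts at \<open>- d < - b\<close>, too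
    far left; translating it by \<open>n\<close> restores the required order.\<close>
  moreover have "A (- (n - c)) (- (n - d))"
    using prev_translate[OF f(1)] by simp
  ultimately have "A (- (- b + n)) (- (- b))"
    by (rule r.arc_of_length_n_at_left_end) (use f in auto)
  then show ?thesis
    by simp
qed

lemma single_translate_crossing:
  assumes saturated: "\<And>u v. v - u \<ge> 2 \<Longrightarrow> \<not> A u v \<Longrightarrow> has_triple (add_orbit n A u v)"
    and "\<not> A a b" "b - a \<ge> 2" "b - a \<le> 2 * n"
  shows "has_triple (add_arc A a b)"
proof (rule ccontr)
  assume free: "\<not> has_triple (add_arc A a b)"
  obtain c d where f: "A c d" "a < c" "c < a + n" "a + n < b" "b < d" "d \<le> c + n"
    using crossing_two_translates[OF saturated free] assms by blast
  \<comment> \<open>\<open>crossing_two_translates\<close> would give \<open>u + n < u + n\<close>.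
    Saturation applies because \<open>a < c < a + n\<close> forces \<open>n \<ge> 2\<close>.\<close>
  have length_n: "has_triple (add_arc A u (u + n))" if "\<not> A u (u + n)" for u
  proof (rule ccontr)
    assume "\<not> has_triple (add_arc A u (u + n))"
    then show False
      using crossing_two_translates[OF saturated[OF _ that]] f n_pos by force
  qed
  have "A a (a + n)"
    using f length_n free by (intro arc_of_length_n_at_left_end[of a b c d]) auto
  moreover have "A (b - n) b"
    using f length_n[of "b - n"] free by (intro arc_of_length_n_at_right_end[of b a c d]) auto
  \<comment> \<open>Here \<open>b - n < c\<close> follows from \<open>b < d\<close> and
    \<open>d \<le> c + n\<close>.\<close>
  ultimately show False
    using has_tripleI[of A a "a + n" "b - n" b c d] f no_triple by auto
qed

end

section \<open>From two-element edges to ordered arcs\<close>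

lemma pair_in_edges_iff: "{u, v} \<in> edges \<longleftrightarrow> u \<noteq> v"
  by (fastforce simp: edges_def doubleton_eq_iff)

lemma edges_cases:
  assumes "e \<in> edges"
  obtains a b where "a < b" "e = {a, b}"
proof -
  obtain u v where "u \<noteq> v" "e = {u, v}"
    using assms by (auto simp: edges_def)
  then show thesis
    using that[of u v] that[of v u] by (cases "u < v") (auto simp: insert_commute)
qed

lemma pair_eq_iff_ordered:
  fixes a b c d :: int
  assumes "a < b" "c < d"
  shows "{a, b} = {c, d} \<longleftrightarrow> a = c \<and> b = d"
  using assms by (auto simp: doubleton_eq_iff)

lemma intersects_ordered_iff:
  assumes "a < b" "c < d"
  shows "intersects {a, b} {c, d} \<longleftrightarrow> a < c \<and> c < b \<and> b < d \<or> c < a \<and> a < d \<and> d < b"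
proof
  assume "intersects {a, b} {c, d}"
  then obtain a1 b1 a2 b2 where eq: "{{a, b}, {c, d}} = {{a1, b1}, {a2, b2}}"
    and ord: "a1 < a2" "a2 < b1" "b1 < b2"
    unfolding intersects_def by blast
  have "{a, b} = {a1, b1} \<and> {c, d} = {a2, b2} \<or> {a, b} = {a2, b2} \<and> {c, d} = {a1, b1}"
    using eq unfolding doubleton_eq_iff[of "{a, b}"] .
  then show "a < c \<and> c < b \<and> b < d \<or> c < a \<and> a < d \<and> d < b"
    using ord assms pair_eq_iff_ordered[of a b a1 b1] pair_eq_iff_ordered[of a b a2 b2]
      pair_eq_iff_ordered[of c d a1 b1] pair_eq_iff_ordered[of c d a2 b2] by linarith
next
  assume "a < c \<and> c < b \<and> b < d \<or> c < a \<and> a < d \<and> d < b"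
  then show "intersects {a, b} {c, d}"
    unfolding intersects_def
  proof
    assume "a < c \<and> c < b \<and> b < d"
    then show "\<exists>a1 b1 a2 b2. {{a, b}, {c, d}} = {{a1, b1}, {a2, b2}} \<and> a1 < a2 \<and> a2 < b1 \<and> b1 < b2"
      by blast
  next
    assume "c < a \<and> a < d \<and> d < b"
    then show "\<exists>a1 b1 a2 b2. {{a, b}, {c, d}} = {{a1, b1}, {a2, b2}} \<and> a1 < a2 \<and> a2 < b1 \<and> b1 < b2"
      by (intro exI[of _ c] exI[of _ d] exI[of _ a] exI[of _ b]) auto
  qed
qed

lemma contains_three_crossing_iff:
  "contains_three_crossing S \<longleftrightarrow> has_triple (\<lambda>i j. {i, j} \<in> S)"
proof
  assume "contains_three_crossing S"
  then obtain X where X: "X \<subseteq> S" "X \<subseteq> edges" "card X = 3" "pairwise intersects X"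
    unfolding contains_three_crossing_def three_crossing_def by blast
  then obtain e f g where efg: "X = {e, f, g}" "e \<noteq> f" "e \<noteq> g" "f \<noteq> g"
    by (auto simp: card_3_iff)
  obtain a1 b1 where e: "a1 < b1" "e = {a1, b1}"
    using efg X edges_cases[of e] by auto
  obtain a2 b2 where f: "a2 < b2" "f = {a2, b2}"
    using efg X edges_cases[of f] by auto
  obtain a3 b3 where g: "a3 < b3" "g = {a3, b3}"
    using efg X edges_cases[of g] by auto
  have "intersects e f" "intersects e g" "intersects f g"
    using X(4) efg by (auto simp: pairwise_def)
  then have cross: "a1 < a2 \<and> a2 < b1 \<and> b1 < b2 \<or> a2 < a1 \<and> a1 < b2 \<and> b2 < b1"
    "a1 < a3 \<and> a3 < b1 \<and> b1 < b3 \<or> a3 < a1 \<and> a1 < b3 \<and> b3 < b1"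
    "a2 < a3 \<and> a3 < b2 \<and> b2 < b3 \<or> a3 < a2 \<and> a2 < b3 \<and> b3 < b2"
    using e f g by (simp_all add: intersects_ordered_iff)
  have S: "{a1, b1} \<in> S" "{a2, b2} \<in> S" "{a3, b3} \<in> S"
    using X(1) efg e f g by auto
  \<comment> \<open>Of the eight sign patterns in \<open>cross\<close>, six are the possible orders
    of the left ends; the other two are cyclic and contradictory.\<close>
  note I = has_tripleI[of "\<lambda>i j. {i, j} \<in> S"]
  show "has_triple (\<lambda>i j. {i, j} \<in> S)"
    using cross I[OF S(1,2,3)] I[OF S(1,3,2)] I[OF S(2,1,3)] I[OF S(2,3,1)] I[OF S(3,1,2)]
      I[OF S(3,2,1)] by (elim disjE conjE) (blast dest: less_trans)+
next
  assume "has_triple (\<lambda>i j. {i, j} \<in> S)"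
  then obtain a1 a2 a3 b1 b2 b3 where
    S: "{a1, b1} \<in> S" "{a2, b2} \<in> S" "{a3, b3} \<in> S"
    and ord: "a1 < a2" "a2 < a3" "a3 < b1" "b1 < b2" "b2 < b3"
    by (rule has_tripleE)
  let ?X = "{{a1, b1}, {a2, b2}, {a3, b3}}"
  have "card ?X = 3"
    using ord by (auto simp: card_3_iff pair_eq_iff_ordered intro!: exI)
  moreover have "?X \<subseteq> edges"
    using ord by (simp add: pair_in_edges_iff)
  moreover have "pairwise intersects ?X"
    using ord by (auto simp: pairwise_def intersects_ordered_iff)
  ultimately show "contains_three_crossing S"
    unfolding contains_three_crossing_def three_crossing_def using S
    by (intro exI[of _ ?X]) auto
qed

lemma proj_translate: "proj n {u + l * int n, v + l * int n} = proj n {u, v}"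
  using proj_eq_iff[of n "{u, v}"] by (metis shift_pair)

lemma pair_in_lift_translate: "{u + l * int n, v + l * int n} \<in> lift n T \<longleftrightarrow> {u, v} \<in> lift n T"
  by (simp add: lift_def proj_translate pair_in_edges_iff)

lemma lift_insert_proj:
  assumes "{i, j} \<in> lift n (insert (proj n {u, v}) T)" "i < j" "u < v"
  shows "add_orbit (int n) (\<lambda>i j. {i, j} \<in> lift n T) u v i j"
proof (cases "proj n {i, j} \<in> T")
  case True
  then show ?thesis
    using assms by (auto simp: add_orbit_def lift_def)
next
  case False
  then have "proj n {u, v} = proj n {i, j}"
    using assms(1) by (auto simp: lift_def)
  then obtain l where "{i, j} = {u + l * int n, v + l * int n}"
    by (auto simp: proj_eq_iff shift_pair)
  then have "i = u + l * int n \<and> j = v + l * int n"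
    using assms by (simp add: pair_eq_iff_ordered)
  then show ?thesis
    by (auto simp: add_orbit_def)
qed

text \<open>The projection of \<open>{u, v}\<close> is admissible by its length and new to
  \<open>T\<close>, so maximality forces a 3-crossing once it is added.\<close>

lemma two_triangulation_saturated:
  assumes T: "two_triangulation n T" and uv: "v - u \<ge> 2" "{u, v} \<notin> lift n T"
  shows "has_triple (add_orbit (int n) (\<lambda>i j. {i, j} \<in> lift n T) u v)"
proof -
  have edge: "{u, v} \<in> edges" "edge_length {u, v} \<ge> 2"
    using uv(1) by (auto simp: pair_in_edges_iff edge_length_pair)
  then have "insert (proj n {u, v}) T \<subseteq> cyl_edges n"
    using T by (auto simp: two_triangulation_def cyl_edges_def)
  moreover have "proj n {u, v} \<notin> T"
    using uv(2) edge by (auto simp: lift_def)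
  ultimately have "contains_three_crossing (lift n (insert (proj n {u, v}) T))"
    using T unfolding two_triangulation_def by blast
  then obtain a1 a2 a3 b1 b2 b3 where
    "{a1, b1} \<in> lift n (insert (proj n {u, v}) T)" "{a2, b2} \<in> lift n (insert (proj n {u, v}) T)"
    "{a3, b3} \<in> lift n (insert (proj n {u, v}) T)"
    and ord: "a1 < a2" "a2 < a3" "a3 < b1" "b1 < b2" "b2 < b3"
    unfolding contains_three_crossing_iff by (rule has_tripleE)
  then show ?thesis
    using uv(1) by (intro has_tripleI[OF _ _ _ ord] lift_insert_proj) auto
qed

theorem corollary3p7:
  fixes n :: nat and T :: "cyl_edge set" and e :: edge
  assumes "n \<ge> 1"
    and "two_triangulation n T"
    and "e \<in> edges"
    and "edge_length e \<ge> 2"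
    and "edge_length e \<le> 2 * int n"
    and "e \<notin> lift n T"
  shows "contains_three_crossing (lift n T \<union> {e})"
proof -
  obtain a b where ab: "a < b" "e = {a, b}"
    using assms(3) by (rule edges_cases)
  interpret periodic_arcs "int n" "\<lambda>i j. {i, j} \<in> lift n T"
    using assms(1,2)
    by unfold_locales
      (auto simp: pair_in_lift_translate two_triangulation_def contains_three_crossing_iff)
  have "has_triple (add_arc (\<lambda>i j. {i, j} \<in> lift n T) a b)"
    using assms(4,5,6) ab two_triangulation_saturated[OF assms(2)]
    by (intro single_translate_crossing) (auto simp: edge_length_pair)
  \<comment> \<open>The shift by \<open>0\<close> turns reindexing into monotonicity in the family
    of arcs.\<close>
  then show ?thesis
    unfolding contains_three_crossing_iff
    by (rule has_triple_reindex[where k = 0]) (auto simp: add_arc_def ab(2))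
qed

end
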